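(* At the critical parameter $p=p_c=\frac{\sqrt5-1}2$, $$\alpha(p_c)\ge\log\frac{14-4\sqrt5}{3}>0.$$
   Context: For $p\in(0,1)$ set $$p_{\mathrm{diamond}}=\frac{p^4}{2p^2-p^4},\qquad p_{\mathrm{series}}=\frac{2p^2-2p^4}{2p^2-p^4}=1-p_{\mathrm{diamond}}.$$ Define random graphs $(G^n)_{n\ge0}$ on one probability space. $G^0$ is a single edge between two vertices $a$ and $b$. Given $G^n$, the graph $G^{n+1}$ is obtained by replacing every edge $\{u,w\}$ of $G^n$, independently of everything else: with probability $p_{\mathrm{diamond}}$ by a diamond, i.e. two internally disjoint paths of length 2 from $u$ to $w$ (a 4-cycle in which $u,w$ are opposite), and with probability $p_{\mathrm{series}}$ by a two-edge series, i.e. a single path of length 2 from $u$ to $w$. The intermediate vertices are new. All edges of $G^n$ have unit resistance, and $R_n$ is the effective resistance between $a$ and $b$ in $G^n$. The exponent is $\alpha(p)=\lim_{n\to\infty}\frac1n\log\mathbb E[R_n]$, which exists for every $p\in(0,1)$ (and is also the almost sure limit of $\frac1n\log R_n$). *)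

theory Defs
  imports "HOL-Probability.Probability"
begin

section \<open>Effective resistance of a finite simple graph\<close>

text \<open>
  A finite simple graph without isolated vertices is given by its set of edges, each edge being a
  two-element set of vertices.  A potential \<open>v\<close> carries unit current from \<open>a\<close> to \<open>b\<close> if, all edges
  having unit resistance (Ohm: the current from \<open>x\<close> to a neighbour \<open>y\<close> is \<open>v x - v y\<close>), the net
  current out of every vertex is \<open>1\<close> at \<open>a\<close>, \<open>-1\<close> at \<open>b\<close> and \<open>0\<close> elsewhere (Kirchhoff).
  The effective resistance is the resulting potential difference; \<open>v\<close> is determined only up to an
  additive constant (on a connected graph), whereas \<open>v a - v b\<close> is unique.
\<close>

definition unit_current_potential :: "'v set set \<Rightarrow> 'v \<Rightarrow> 'v \<Rightarrow> ('v \<Rightarrow> real) \<Rightarrow> bool" where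
  "unit_current_potential E a b v \<longleftrightarrow>
     (\<forall>x\<in>\<Union>E. (\<Sum>y | {x, y} \<in> E. v x - v y) = (if x = a then 1 else if x = b then - 1 else 0))"

definition eff_resistance :: "'v set set \<Rightarrow> 'v \<Rightarrow> 'v \<Rightarrow> real" where
  "eff_resistance E a b = (THE r. \<exists>v. unit_current_potential E a b v \<and> r = v a - v b)"

section \<open>The random hierarchical graphs\<close>

definition p_diamond :: "real \<Rightarrow> real" where
  "p_diamond p = p ^ 4 / (2 * p ^ 2 - p ^ 4)"

definition p_series :: "real \<Rightarrow> real" where
  "p_series p = (2 * p ^ 2 - 2 * p ^ 4) / (2 * p ^ 2 - p ^ 4)"

text \<open>
  \<open>Mid u w i\<close> is the intermediate vertex number \<open>i\<close> created when the edge \<open>{u, w}\<close> is replaced.  To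
  name it, each edge is stored in one fixed orientation \<open>(u, w)\<close> (pointing from the \<open>a\<close> side to the
  \<open>b\<close> side); the orientation is forgotten in \<open>graph\<close>.
\<close>

datatype vertex = Vert_a | Vert_b | Mid vertex vertex bool

type_synonym arc = "vertex \<times> vertex"

fun series_arcs :: "arc \<Rightarrow> arc set" where
  "series_arcs (u, w) = {(u, Mid u w False), (Mid u w False, w)}"

fun diamond_arcs :: "arc \<Rightarrow> arc set" where
  "diamond_arcs (u, w) =
     {(u, Mid u w False), (Mid u w False, w), (u, Mid u w True), (Mid u w True, w)}"

text \<open>
  The sample point \<open>\<omega>\<close> assigns a coin to every potential edge, \<open>True\<close> meaning diamond.  An edge
  can occur in \<open>arcs n \<omega>\<close> for at most one \<open>n\<close>, so no coin is used twice.
\<close>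

primrec arcs :: "nat \<Rightarrow> (arc \<Rightarrow> bool) \<Rightarrow> arc set" where
  "arcs 0 \<omega> = {(Vert_a, Vert_b)}"
| "arcs (Suc n) \<omega> = (\<Union>e\<in>arcs n \<omega>. if \<omega> e then diamond_arcs e else series_arcs e)"

definition graph :: "nat \<Rightarrow> (arc \<Rightarrow> bool) \<Rightarrow> vertex set set" where
  "graph n \<omega> = (\<lambda>(u, w). {u, w}) ` arcs n \<omega>"

definition coin_space :: "real \<Rightarrow> (arc \<Rightarrow> bool) measure" where
  "coin_space p = PiM UNIV (\<lambda>_. measure_pmf (bernoulli_pmf (p_diamond p)))"

definition R :: "nat \<Rightarrow> (arc \<Rightarrow> bool) \<Rightarrow> real" where
  "R n \<omega> = eff_resistance (graph n \<omega>) Vert_a Vert_b"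

definition \<alpha> :: "real \<Rightarrow> real" where
  "\<alpha> p = lim (\<lambda>n. ln (LINT \<omega>|coin_space p. R n \<omega>) / real n)"

definition p_c :: real where
  "p_c = (sqrt 5 - 1) / 2"

lemma p_diamond_p_series:
  assumes "0 < p" "p < 1"
  shows "0 < p_diamond p" "p_diamond p < 1" "p_series p = 1 - p_diamond p"
    and "pmf (bernoulli_pmf (p_diamond p)) True = p_diamond p"
    and "pmf (bernoulli_pmf (p_diamond p)) False = p_series p"
proof -
  have lt: "p ^ 4 < p ^ 2" and pos: "0 < p ^ 4"
    using assms by (auto intro: power_strict_decreasing)
  then have den: "0 < 2 * p ^ 2 - p ^ 4" by linarith
  show 1: "0 < p_diamond p" and 2: "p_diamond p < 1" and 3: "p_series p = 1 - p_diamond p"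
    using lt pos den by (auto simp: p_diamond_def p_series_def field_simps)
  show "pmf (bernoulli_pmf (p_diamond p)) True = p_diamond p"
    "pmf (bernoulli_pmf (p_diamond p)) False = p_series p"
    using 1 2 3 by auto
qed

end

theory Submission
  imports Defs
begin

text \<open>
  Splitting at the first replacement step, \<open>R (n + 1)\<close> is distributed as \<open>x + y\<close> (series) or as
  \<open>A B / (A + B)\<close> with \<open>A = x + y\<close> and \<open>B = z + t\<close> (diamond), where \<open>x, y, z, t\<close> are independent
  copies of \<open>R n\<close>.  Write \<open>m = E (R n)\<close>, \<open>s = E (R n ^ 2)\<close> and \<open>q\<close> for the probability of a diamond.
  If \<open>s \<le> 2 m ^ 2\<close> then \<open>E (A B / (A + B)) \<ge> 2 m / 3\<close>, so the mean grows at least by the factor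
  \<open>2 (1 - q) + 2 q / 3 = 2 - 4 q / 3\<close>, while \<open>(A B / (A + B)) ^ 2 \<le> A B / 4\<close> bounds the next second
  moment by \<open>(6 - 5 q) m ^ 2\<close>; for \<open>q \<le> 1/2\<close> the condition on the second moment is therefore
  preserved.  At the critical point \<open>q = sqrt 5 - 2\<close>.

  The limit exists because the mean is submultiplicative: the recursion preserves the
  increasing concave order, and \<open>R k\<close> lies below the constant \<open>E (R k)\<close> by Jensen.
\<close>

section \<open>Series-parallel reduction\<close>

definition parallel :: "real \<Rightarrow> real \<Rightarrow> real" where
  "parallel x y = x * y / (x + y)"

lemma parallel_pos: "0 < x \<Longrightarrow> 0 < y \<Longrightarrow> 0 < parallel x y"
  by (simp add: parallel_def)

definition children :: "(arc \<Rightarrow> bool) \<Rightarrow> arc \<Rightarrow> arc set" where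
  "children \<omega> e = (if \<omega> e then diamond_arcs e else series_arcs e)"

text \<open>The recursion branches at the root, whereas \<open>arcs\<close> refines the last
  generation. This makes subnetworks below arbitrary arcs accessible to induction.\<close>

primrec expand :: "nat \<Rightarrow> (arc \<Rightarrow> bool) \<Rightarrow> arc \<Rightarrow> arc set" where
  "expand 0 \<omega> e = {e}"
| "expand (Suc n) \<omega> e = (\<Union>c\<in>children \<omega> e. expand n \<omega> c)"

text \<open>Equivalent resistance obtained from the series and parallel laws alone;
  \<open>R_eq_res\<close> identifies it with the effective resistance at the root arc.\<close>

fun res :: "nat \<Rightarrow> (arc \<Rightarrow> bool) \<Rightarrow> arc \<Rightarrow> real" where
  "res 0 \<omega> e = 1"
| "res (Suc n) \<omega> (u, w) =
     (let s = \<lambda>i. res n \<omega> (u, Mid u w i) + res n \<omega> (Mid u w i, w)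
      in if \<omega> (u, w) then parallel (s False) (s True) else s False)"

lemma expand_Suc_last: "expand (Suc n) \<omega> e = (\<Union>d\<in>expand n \<omega> e. children \<omega> d)"
proof (induction n arbitrary: e)
  case (Suc n)
  have "expand (Suc (Suc n)) \<omega> e = (\<Union>c\<in>children \<omega> e. \<Union>d\<in>expand n \<omega> c. children \<omega> d)"
    by (simp only: expand.simps(2)[of "Suc n"] Suc)
  then show ?case by simp
qed simp

lemma arcs_eq_expand: "arcs n \<omega> = expand n \<omega> (Vert_a, Vert_b)"
  by (induction n) (simp_all only: arcs.simps expand.simps(1) expand_Suc_last children_def)

lemma res_pos: "0 < res n \<omega> e"
  by (induction n \<omega> e rule: res.induct) (auto simp: Let_def intro!: parallel_pos add_pos_pos)

section \<open>The genealogy of arcs and of the vertices created below them\<close>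

definition child_rel :: "(arc \<times> arc) set" where
  "child_rel = {(e, c). c \<in> diamond_arcs e}"

lemma child_rel_iff: "(e, c) \<in> child_rel \<longleftrightarrow> c \<in> diamond_arcs e"
  by (simp add: child_rel_def)

text \<open>All four potential children count, whatever the coins say, so the forest of arcs is
  deterministic.\<close>

definition descendants :: "arc \<Rightarrow> arc set" where
  "descendants e = {d. (e, d) \<in> child_rel\<^sup>*}"

text \<open>Independent of \<open>n\<close> and \<omega>: every vertex that some coins could create
  below \<open>e\<close>. Those not actually created touch no arc and carry zero current.\<close>

definition interior_vertices :: "arc \<Rightarrow> vertex set" where
  "interior_vertices e = (\<Union>(u, w)\<in>descendants e. range (Mid u w))"

abbreviation arc_size :: "arc \<Rightarrow> nat" where
  "arc_size e \<equiv> size (fst e) + size (snd e)"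

text \<open>
  The larger endpoint of a child arc is the \<open>Mid\<close> vertex that records its parent, so arcs form a
  forest under \<open>child_rel\<close> and distinct siblings have disjoint descendants.
\<close>

lemma arc_size_child: "c \<in> diamond_arcs e \<Longrightarrow> arc_size e < arc_size c"
  by (cases e) auto

text \<open>If both parents contribute their \<open>Mid\<close> vertex at the same end of
  \<open>c\<close>, injectivity of \<open>Mid\<close> identifies them. At opposite ends, each
  \<open>Mid\<close> would be a component of the other, which sizes exclude.\<close>

lemma parent_unique:
  assumes "c \<in> diamond_arcs e" "c \<in> diamond_arcs e'"
  shows "e = e'"
proof -
  obtain u w u' w' where e: "e = (u, w)" "e' = (u', w')" by (cases e; cases e')
  have "Mid u w i = u' \<Longrightarrow> u = Mid u' w' j \<Longrightarrow> False" for i j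
    by (drule arg_cong[where f = size], drule arg_cong[where f = size]) simp
  moreover have "Mid u w i = w' \<Longrightarrow> u = Mid u' w' j \<Longrightarrow> False" for i j
    by (drule arg_cong[where f = size], drule arg_cong[where f = size]) simp
  moreover have "Mid u w i = u' \<Longrightarrow> w = Mid u' w' j \<Longrightarrow> False" for i j
    by (drule arg_cong[where f = size], drule arg_cong[where f = size]) simp
  ultimately show ?thesis
    using assms e by auto
qed

lemma single_valued_parent: "single_valued (child_rel\<inverse>)"
  using parent_unique by (auto simp: single_valued_def child_rel_def)

lemma arc_size_descendant: "d \<in> descendants e \<Longrightarrow> arc_size e \<le> arc_size d"
  unfolding descendants_def mem_Collect_eq
  by (induction rule: rtrancl_induct) (auto simp: child_rel_def dest!: arc_size_child)

lemma descendants_refl [simp]: "e \<in> descendants e"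
  by (simp add: descendants_def)

lemma child_descendant: "c \<in> diamond_arcs e \<Longrightarrow> d \<in> descendants c \<Longrightarrow> d \<in> descendants e"
  by (auto simp: descendants_def child_rel_def intro: converse_rtrancl_into_rtrancl)

lemma descendants_unfold: "descendants e = insert e (\<Union>c\<in>diamond_arcs e. descendants c)"
proof (intro subset_antisym subsetI)
  fix d
  assume "d \<in> descendants e"
  then have "d = e \<or> (\<exists>c. (e, c) \<in> child_rel \<and> (c, d) \<in> child_rel\<^sup>*)"
    unfolding descendants_def mem_Collect_eq by (metis converse_rtranclE)
  then show "d \<in> insert e (\<Union>c\<in>diamond_arcs e. descendants c)"
    by (simp only: insert_iff UN_iff descendants_def mem_Collect_eq child_rel_iff Bex_def)
next
  fix d
  assume "d \<in> insert e (\<Union>c\<in>diamond_arcs e. descendants c)"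
  then show "d \<in> descendants e" by (blast intro: child_descendant descendants_refl)
qed

lemma not_descendant_of_child: "c \<in> diamond_arcs e \<Longrightarrow> e \<notin> descendants c"
  using arc_size_child arc_size_descendant by (meson leD)

text \<open>A path of descent from \<open>c\<close> to \<open>c'\<close> would enter
  \<open>c'\<close> through the common parent \<open>e\<close>, making \<open>e\<close> a descendant
  of its own child.\<close>

lemma sibling_not_descendant:
  assumes "c \<in> diamond_arcs e" "c' \<in> diamond_arcs e" "c \<noteq> c'"
  shows "c' \<notin> descendants c"
proof
  assume "c' \<in> descendants c"
  then obtain d where "(c, d) \<in> child_rel\<^sup>*" "(d, c') \<in> child_rel"
    using assms(3) by (auto simp: descendants_def elim: rtranclE)
  then have "e \<in> descendants c"
    using parent_unique[OF assms(2)] by (auto simp: descendants_def child_rel_def)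
  then show False
    using not_descendant_of_child assms(1) by blast
qed

text \<open>Parents are unique, so two ancestors of the same arc are comparable, which siblings are
  not. Both the additivity of currents and the independence of subnetworks rest on this.\<close>

lemma siblings_disjoint:
  assumes "c \<in> diamond_arcs e" "c' \<in> diamond_arcs e" "c \<noteq> c'"
  shows "descendants c \<inter> descendants c' = {}"
proof -
  have "(c, c') \<in> child_rel\<^sup>* \<or> (c', c) \<in> child_rel\<^sup>*"
    if "d \<in> descendants c" "d \<in> descendants c'" for d
    using single_valued_confluent[OF single_valued_parent, of d c c'] that
    by (auto simp: descendants_def rtrancl_converse)
  then show ?thesis
    using sibling_not_descendant assms unfolding descendants_def by blast
qed

lemma interior_vertices_unfold:
  "interior_vertices (u, w) = range (Mid u w) \<union> (\<Union>c\<in>diamond_arcs (u, w). interior_vertices c)"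
  unfolding interior_vertices_def by (subst descendants_unfold) (simp del: diamond_arcs.simps)

lemma Mid_interior: "Mid u w i \<in> interior_vertices (u, w)"
  unfolding interior_vertices_def by (rule UN_I[OF descendants_refl]) simp

lemma interior_vertices_child: "c \<in> diamond_arcs e \<Longrightarrow> interior_vertices c \<subseteq> interior_vertices e"
  unfolding interior_vertices_def by (rule UN_mono) (auto intro: child_descendant)

lemma interior_vertices_siblings_disjoint:
  assumes "c \<in> diamond_arcs e" "c' \<in> diamond_arcs e" "c \<noteq> c'"
  shows "interior_vertices c \<inter> interior_vertices c' = {}"
  using siblings_disjoint[OF assms] by (auto simp: interior_vertices_def)

lemma size_interior_vertex: "x \<in> interior_vertices e \<Longrightarrow> arc_size e < size x"
  by (auto simp: interior_vertices_def dest!: arc_size_descendant)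

definition vertices :: "arc \<Rightarrow> vertex set" where
  "vertices e = {fst e, snd e} \<union> interior_vertices e"

lemma children_subset: "children \<omega> e \<subseteq> diamond_arcs e"
  by (cases e) (auto simp: children_def)

lemma finite_children: "finite (children \<omega> e)"
  by (cases e) (auto simp: children_def)

lemma finite_expand: "finite (expand n \<omega> e)"
  by (induction n arbitrary: e) (auto simp: finite_children)

lemma expand_SucE:
  assumes "d \<in> expand (Suc n) \<omega> e"
  obtains c where "c \<in> diamond_arcs e" "c \<in> children \<omega> e" "d \<in> expand n \<omega> c"
  using assms children_subset[of \<omega> e] unfolding expand.simps by blast

lemma expand_descendant: "d \<in> expand n \<omega> e \<Longrightarrow> d \<in> descendants e"
proof (induction n arbitrary: e)
  case (Suc n)
  then show ?case by (elim expand_SucE) (blast intro: child_descendant)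
qed simp

lemma vertices_child: "c \<in> diamond_arcs e \<Longrightarrow> vertices c \<subseteq> vertices e"
  using interior_vertices_child[of c e] Mid_interior by (cases e) (auto simp: vertices_def)

lemma expand_vertices: "(s, t) \<in> expand n \<omega> e \<Longrightarrow> s \<in> vertices e \<and> t \<in> vertices e"
proof (induction n arbitrary: e)
  case (Suc n)
  then show ?case by (elim expand_SucE) (blast dest: vertices_child)
qed (auto simp: vertices_def)

section \<open>Kirchhoff currents and the equivalent resistor\<close>

text \<open>The net current flowing out of \<open>x\<close> through the arcs of \<open>A\<close>, regarded as undirected unit resistors.\<close>

definition current :: "arc set \<Rightarrow> (vertex \<Rightarrow> real) \<Rightarrow> vertex \<Rightarrow> real" where
  "current A v x = (\<Sum>(s, t)\<in>A. (if s = x then v s - v t else 0) + (if t = x then v t - v s else 0))"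

lemma current_expand_Suc:
  "current (expand (Suc n) \<omega> e) v x = (\<Sum>c\<in>children \<omega> e. current (expand n \<omega> c) v x)"
  unfolding current_def expand.simps
proof (rule sum.UNION_disjoint)
  show "\<forall>c\<in>children \<omega> e. \<forall>c'\<in>children \<omega> e. c \<noteq> c' \<longrightarrow> expand n \<omega> c \<inter> expand n \<omega> c' = {}"
    using siblings_disjoint children_subset expand_descendant by blast
qed (simp_all add: finite_children finite_expand)

lemma current_outside: "x \<notin> vertices e \<Longrightarrow> current (expand n \<omega> e) v x = 0"
  unfolding current_def by (rule sum.neutral) (auto dest: expand_vertices)

lemma current_cong:
  "(\<And>y. y \<in> vertices e \<Longrightarrow> v y = v' y) \<Longrightarrow> current (expand n \<omega> e) v x = current (expand n \<omega> e) v' x"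
  unfolding current_def by (intro sum.cong refl) (auto dest!: expand_vertices)

text \<open>No other child reaches \<open>x\<close>: interiors of siblings are disjoint, and
  \<open>x\<close> is larger than the endpoints of every child of \<open>e\<close>.\<close>

lemma current_interior:
  assumes "c \<in> diamond_arcs e" "x \<in> interior_vertices c"
  shows "current (expand (Suc n) \<omega> e) v x =
    (if c \<in> children \<omega> e then current (expand n \<omega> c) v x else 0)"
proof -
  have "current (expand n \<omega> c') v x = 0" if c': "c' \<in> children \<omega> e" "c' \<noteq> c" for c'
  proof (rule current_outside)
    have c'': "c' \<in> diamond_arcs e" using c' children_subset by blast
    have "x \<notin> interior_vertices c'"
      using interior_vertices_siblings_disjoint[OF assms(1) c''] c' assms(2) by blast
    moreover have "x \<noteq> fst c'" "x \<noteq> snd c'"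
      using size_interior_vertex[OF assms(2)] assms(1) c'' by (cases e; auto)+
    ultimately show "x \<notin> vertices c'" by (simp add: vertices_def)
  qed
  then have "(\<Sum>c'\<in>children \<omega> e. current (expand n \<omega> c') v x) =
      (\<Sum>c'\<in>children \<omega> e. if c' = c then current (expand n \<omega> c) v x else 0)"
    by (intro sum.cong) auto
  then show ?thesis
    by (simp add: current_expand_Suc finite_children del: expand.simps)
qed

lemma Mid_not_interior_child:
  assumes "c \<in> diamond_arcs (u, w)"
  shows "Mid u w i \<notin> interior_vertices c" "u \<notin> interior_vertices c" "w \<notin> interior_vertices c"
  using size_interior_vertex[of _ c] assms by force+

lemma Mid_neq [simp]: "Mid u w i \<noteq> u" "Mid u w i \<noteq> w" "u \<noteq> Mid u w i" "w \<noteq> Mid u w i"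
proof -
  show "Mid u w i \<noteq> u" by (rule size_neq_size_imp_neq) simp
  show "Mid u w i \<noteq> w" by (rule size_neq_size_imp_neq) simp
  show "u \<noteq> Mid u w i" by (rule size_neq_size_imp_neq) simp
  show "w \<noteq> Mid u w i" by (rule size_neq_size_imp_neq) simp
qed

lemma current_expand_Suc':
  assumes "u \<noteq> w"
  shows "current (expand (Suc n) \<omega> (u, w)) v x =
    (let K = \<lambda>i. current (expand n \<omega> (u, Mid u w i)) v x + current (expand n \<omega> (Mid u w i, w)) v x
     in K False + (if \<omega> (u, w) then K True else 0))"
  using assms unfolding current_expand_Suc by (auto simp: children_def Let_def)

lemma current_branch:
  assumes "u \<noteq> w"
  shows "current (expand n \<omega> (u, Mid u w i)) v w = 0"
    and "current (expand n \<omega> (Mid u w i, w)) v u = 0"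
    and "i \<noteq> j \<Longrightarrow> current (expand n \<omega> (u, Mid u w i)) v (Mid u w j) = 0"
    and "i \<noteq> j \<Longrightarrow> current (expand n \<omega> (Mid u w i, w)) v (Mid u w j) = 0"
  using assms Mid_not_interior_child[of _ u w]
  by (auto intro!: current_outside simp: vertices_def)

text \<open>Zero net current at the middle forces \<open>m\<close> to be a weighted mean of
  \<open>x\<close> and \<open>y\<close>; substituting it merges the two resistors into one.\<close>

lemma series_law:
  fixes r r' :: real
  assumes "0 < r" "0 < r'" "(m - x) / r + (m - y) / r' = 0"
  shows "(x - m) / r = (x - y) / (r + r')" "(y - m) / r' = (y - x) / (r + r')"
proof -
  have "m = (r' * x + r * y) / (r + r')"
    using assms by (simp add: field_simps)
  then show "(x - m) / r = (x - y) / (r + r')" "(y - m) / r' = (y - x) / (r + r')"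
    using assms by (simp_all add: field_simps)
qed

lemma parallel_law: "0 < r \<Longrightarrow> 0 < r' \<Longrightarrow> d / r + d / r' = d / parallel r r'"
  by (simp add: parallel_def field_simps)

text \<open>A potential balanced in the interior sees the network below \<open>e\<close> as one
  resistor. By induction each half of a branch is a resistor, the series law eliminates the middle
  vertex, and the parallel law joins the two branches of a diamond.\<close>

lemma current_through_expand:
  assumes "fst e \<noteq> snd e" and "\<And>x. x \<in> interior_vertices e \<Longrightarrow> current (expand n \<omega> e) v x = 0"
  shows "current (expand n \<omega> e) v (fst e) = (v (fst e) - v (snd e)) / res n \<omega> e \<and>
    current (expand n \<omega> e) v (snd e) = (v (snd e) - v (fst e)) / res n \<omega> e"
  using assms
proof (induction n arbitrary: e)
  case 0
  then show ?case by (cases e) (auto simp: current_def)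
next
  case (Suc n)
  obtain u w where e: "e = (u, w)" by (cases e)
  have neq: "u \<noteq> w" using Suc.prems e by simp
  define s where "s i = res n \<omega> (u, Mid u w i) + res n \<omega> (Mid u w i, w)" for i
  define K where "K i x = current (expand n \<omega> (u, Mid u w i)) v x +
    current (expand n \<omega> (Mid u w i, w)) v x" for i x
  have total: "current (expand (Suc n) \<omega> e) v x = K False x + (if \<omega> e then K True x else 0)" for x
    unfolding e K_def by (subst current_expand_Suc'[OF neq]) (simp only: Let_def)
  \<comment> \<open>Branch \<open>False\<close> is always present, branch \<open>True\<close> only
    in a diamond.\<close>
  have branch: "K i u = (v u - v w) / s i \<and> K i w = (v w - v u) / s i" if i: "i = False \<or> \<omega> e" for i
  proof -
    let ?m = "Mid u w i"
    have child: "fst c \<noteq> snd c \<and> (\<forall>x\<in>interior_vertices c. current (expand n \<omega> c) v x = 0)"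
      if c: "c \<in> {(u, ?m), (?m, w)}" for c
    proof
      have cc: "c \<in> diamond_arcs e" "c \<in> children \<omega> e"
        using c i e by (auto simp: children_def)
      then have "x \<in> interior_vertices c \<Longrightarrow> x \<in> interior_vertices e" for x
        using interior_vertices_child by blast
      then show "\<forall>x\<in>interior_vertices c. current (expand n \<omega> c) v x = 0"
        using Suc.prems(2) current_interior[OF cc(1)] cc(2) by metis
      show "fst c \<noteq> snd c" using c by auto
    qed
    have 1: "current (expand n \<omega> (u, ?m)) v u = (v u - v ?m) / res n \<omega> (u, ?m)"
      "current (expand n \<omega> (u, ?m)) v ?m = (v ?m - v u) / res n \<omega> (u, ?m)"
      using Suc.IH[of "(u, ?m)"] child[of "(u, ?m)"] by simp_all
    have 2: "current (expand n \<omega> (?m, w)) v ?m = (v ?m - v w) / res n \<omega> (?m, w)"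
      "current (expand n \<omega> (?m, w)) v w = (v w - v ?m) / res n \<omega> (?m, w)"
      using Suc.IH[of "(?m, w)"] child[of "(?m, w)"] by simp_all
    have "?m \<in> interior_vertices e" by (simp add: e Mid_interior)
    then have "K False ?m + (if \<omega> e then K True ?m else 0) = 0"
      using Suc.prems(2) total by metis
    \<comment> \<open>The other branch does not touch \<open>?m\<close>, so balance at
      \<open>?m\<close> concerns branch \<open>i\<close> alone.\<close>
    moreover have "K (\<not> i) ?m = 0"
      by (simp add: K_def current_branch(3,4)[OF neq])
    ultimately have "K i ?m = 0"
      using i by (cases i) (simp_all split: if_splits)
    then have "(v ?m - v u) / res n \<omega> (u, ?m) + (v ?m - v w) / res n \<omega> (?m, w) = 0"
      by (simp add: K_def 1 2)
    from series_law[OF res_pos res_pos this] show ?thesis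
      by (simp add: K_def s_def 1 2 current_branch[OF neq])
  qed
  have s_pos: "0 < s i" for i by (simp add: s_def add_pos_pos res_pos)
  have res: "res (Suc n) \<omega> e = (if \<omega> e then parallel (s False) (s True) else s False)"
    by (simp add: e s_def Let_def)
  show ?case
    unfolding total res
    using branch[of False] branch[of True] parallel_law[OF s_pos s_pos] by (auto simp: e)
qed

text \<open>A Dirichlet problem with prescribed values outside the interior: choose the middle
  values first, then solve recursively inside the four children, whose interiors are
  disjoint.\<close>

lemma ex_potential:
  assumes "fst e \<noteq> snd e"
  shows "\<exists>v'. (\<forall>x. x \<notin> interior_vertices e \<longrightarrow> v' x = v x) \<and>
    (\<forall>x\<in>interior_vertices e. current (expand n \<omega> e) v' x = 0)"
  using assms
proof (induction n arbitrary: e v)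
  case 0
  have "current (expand 0 \<omega> e) v x = 0" if "x \<in> interior_vertices e" for x
    using size_interior_vertex[OF that] by (cases e) (auto simp: current_def)
  then show ?case by blast
next
  case (Suc n)
  obtain u w where e: "e = (u, w)" by (cases e)
  have neq: "u \<noteq> w" using Suc.prems e by simp
  define r r' where "r i = res n \<omega> (u, Mid u w i)" and "r' i = res n \<omega> (Mid u w i, w)" for i
  have r_pos: "0 < r i" "0 < r' i" for i by (simp_all add: r_def r'_def res_pos)
  \<comment> \<open>The value at which the currents through resistances \<open>r i\<close> and
    \<open>r' i\<close> balance.\<close>
  define m where "m i = (r' i * v u + r i * v w) / (r i + r' i)" for i
  \<comment> \<open>Both middle values are set whatever the coin shows, which avoids a case
    distinction.\<close>
  define v0 where "v0 = v(Mid u w False := m False, Mid u w True := m True)"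
  have v0_Mid: "v0 (Mid u w i) = m i" for i
    by (cases i) (simp_all add: v0_def)
  have v0_other: "v0 x = v x" if "x \<notin> range (Mid u w)" for x
    unfolding v0_def using that by (metis fun_upd_other rangeI)
  have v0_ends: "v0 u = v u" "v0 w = v w" by (auto intro!: v0_other)
  have child_neq: "fst c \<noteq> snd c" if "c \<in> diamond_arcs e" for c
    using that by (auto simp: e)
  have "\<forall>c\<in>diamond_arcs e. \<exists>g. (\<forall>x. x \<notin> interior_vertices c \<longrightarrow> g x = v0 x) \<and>
      (\<forall>x\<in>interior_vertices c. current (expand n \<omega> c) g x = 0)"
    using Suc.IH child_neq by blast
  then obtain g where g: "\<And>c x. c \<in> diamond_arcs e \<Longrightarrow> x \<notin> interior_vertices c \<Longrightarrow> g c x = v0 x"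
    "\<And>c x. c \<in> diamond_arcs e \<Longrightarrow> x \<in> interior_vertices c \<Longrightarrow> current (expand n \<omega> c) (g c) x = 0"
    by metis
  \<comment> \<open>Gluing: at most one child has \<open>x\<close> in its interior, so the choice is
    unambiguous.\<close>
  define v' where "v' x = (if \<exists>c\<in>diamond_arcs e. x \<in> interior_vertices c
    then g (SOME c. c \<in> diamond_arcs e \<and> x \<in> interior_vertices c) x else v0 x)" for x
  have v'_child: "v' x = g c x" if c: "c \<in> diamond_arcs e" "x \<in> interior_vertices c" for c x
  proof -
    have "(SOME c. c \<in> diamond_arcs e \<and> x \<in> interior_vertices c) = c"
      using c interior_vertices_siblings_disjoint by (intro some_equality) blast+
    then show ?thesis using c by (auto simp: v'_def)
  qed
  have v'_base: "v' x = v0 x" if "x \<in> {u, w} \<union> range (Mid u w)" for x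
    using that Mid_not_interior_child[of _ u w] by (auto simp: v'_def e simp del: diamond_arcs.simps)
  have ends: "fst c \<in> {u, w} \<union> range (Mid u w)" "snd c \<in> {u, w} \<union> range (Mid u w)"
    if "c \<in> diamond_arcs e" for c
    using that by (auto simp: e)
  have not_int: "x \<notin> interior_vertices c"
    if "c \<in> diamond_arcs e" "x \<in> {u, w} \<union> range (Mid u w)" for c x
    using that Mid_not_interior_child[of c u w] by (auto simp: e simp del: diamond_arcs.simps)
  have agree: "v' x = g c x" if c: "c \<in> diamond_arcs e" and x: "x \<in> vertices c" for c x
  proof (cases "x \<in> interior_vertices c")
    case False
    then have "x \<in> {u, w} \<union> range (Mid u w)"
      using x ends[OF c] by (auto simp: vertices_def)
    then show ?thesis using v'_base g(1)[OF c False] by simp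
  qed (simp add: v'_child[OF c])
  have child0: "current (expand n \<omega> c) v' x = 0"
    if c: "c \<in> diamond_arcs e" and x: "x \<in> interior_vertices c" for c x
    unfolding g(2)[OF c x, symmetric] by (rule current_cong) (rule agree[OF c])
  have mid: "current (expand n \<omega> (u, Mid u w i)) v' (Mid u w i) +
      current (expand n \<omega> (Mid u w i, w)) v' (Mid u w i) = 0" for i
  proof -
    let ?m = "Mid u w i"
    have "current (expand n \<omega> (u, ?m)) v' ?m = (v' ?m - v' u) / r i"
      using current_through_expand[of "(u, ?m)" n \<omega> v'] child0[of "(u, ?m)"]
      by (cases i) (simp_all add: e r_def)
    moreover have "current (expand n \<omega> (?m, w)) v' ?m = (v' ?m - v' w) / r' i"
      using current_through_expand[of "(?m, w)" n \<omega> v'] child0[of "(?m, w)"]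
      by (cases i) (simp_all add: e r'_def)
    moreover have "v' u = v u" "v' w = v w" "v' ?m = (r' i * v u + r i * v w) / (r i + r' i)"
      using v'_base v0_ends v0_Mid by (simp_all add: m_def)
    moreover have "((r' i * x + r i * y) / (r i + r' i) - x) / r i +
        ((r' i * x + r i * y) / (r i + r' i) - y) / r' i = 0" for x y
    proof -
      have "r i + r' i > 0" using r_pos by (simp add: add_pos_pos)
      then show ?thesis using r_pos[of i] by (simp add: divide_simps) (simp add: algebra_simps)
    qed
    ultimately show ?thesis by metis
  qed
  have "current (expand (Suc n) \<omega> e) v' x = 0" if x: "x \<in> interior_vertices e" for x
  proof (cases "x \<in> range (Mid u w)")
    case True
    then obtain j where j: "x = Mid u w j" by blast
    have "current (expand n \<omega> (u, Mid u w i)) v' x + current (expand n \<omega> (Mid u w i, w)) v' x = 0" for i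
      using mid[of j] by (cases "i = j") (simp_all only: j current_branch(3,4)[OF neq] simp_thms add_0)
    then show ?thesis
      unfolding e by (subst current_expand_Suc'[OF neq]) (simp only: Let_def, simp)
  next
    case False
    then obtain c where c: "c \<in> diamond_arcs e" "x \<in> interior_vertices c"
      using x unfolding e interior_vertices_unfold[of u w] by blast
    then show ?thesis by (simp add: current_interior[OF c] child0[OF c] del: expand.simps)
  qed
  moreover have "v' x = v x" if "x \<notin> interior_vertices e" for x
  proof -
    have "x \<notin> range (Mid u w)" "\<not> (\<exists>c\<in>diamond_arcs e. x \<in> interior_vertices c)"
      using that unfolding e interior_vertices_unfold[of u w] by blast+
    then show ?thesis using v0_other by (simp add: v'_def)
  qed
  ultimately show ?case by blast
qed

section \<open>From oriented arcs to the undirected graph\<close>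

lemma expand_simple:
  assumes "fst e \<noteq> snd e" "(s, t) \<in> expand n \<omega> e"
  shows "s \<noteq> t \<and> (t, s) \<notin> expand n \<omega> e"
proof (cases n)
  case 0
  then show ?thesis using assms by auto
next
  case (Suc m)
  have nonloop: "s' \<noteq> t'" if "(s', t') \<in> expand n \<omega> e" for n s' t'
    using assms(1) that
  proof (induction n arbitrary: e)
    case (Suc n)
    then obtain c where "c \<in> diamond_arcs e" "(s', t') \<in> expand n \<omega> c"
      by (blast elim: expand_SucE)
    moreover from this have "fst c \<noteq> snd c" by (cases e) auto
    ultimately show ?case using Suc.IH by blast
  qed auto
  have "(t, s) \<notin> expand n \<omega> e"
  proof
    assume ts: "(t, s) \<in> expand n \<omega> e"
    obtain d where d: "d \<in> expand m \<omega> e" "(s, t) \<in> diamond_arcs d"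
      using assms(2) children_subset unfolding Suc expand_Suc_last by fast
    obtain d' where d': "d' \<in> expand m \<omega> e" "(t, s) \<in> diamond_arcs d'"
      using ts children_subset unfolding Suc expand_Suc_last by fast
    obtain x y x' y' where xy: "d = (x, y)" "d' = (x', y')" by (cases d; cases d')
    have size: "Mid x y i = x' \<Longrightarrow> Mid x' y' j = x \<Longrightarrow> False"
      "Mid x y i = x' \<Longrightarrow> Mid x' y' j = y \<Longrightarrow> False"
      "Mid x y i = y' \<Longrightarrow> Mid x' y' j = x \<Longrightarrow> False"
      "Mid x y i = y' \<Longrightarrow> Mid x' y' j = y \<Longrightarrow> False" for i j
      by (drule arg_cong[where f = size], drule arg_cong[where f = size], simp)+
    \<comment> \<open>Either the two \<open>Mid\<close> vertices would contain each other, or they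
      are equal; then \<open>d\<close> and \<open>d'\<close> coincide and must be a loop.\<close>
    have "x = y"
      using d(2) d'(2) xy size by (auto dest: size)
    then show False using nonloop d(1) xy by blast
  qed
  then show ?thesis using nonloop assms(2) by blast
qed

text \<open>By \<open>expand_simple\<close> there are neither loops nor opposite arcs, so each
  neighbour of \<open>x\<close> comes from exactly one arc, outgoing or incoming.\<close>

lemma neighbour_sum_eq_current:
  "(\<Sum>y | {x, y} \<in> graph n \<omega>. v x - v y) = current (arcs n \<omega>) v x"
proof -
  let ?A = "arcs n \<omega>"
  have fin: "finite ?A" by (simp add: arcs_eq_expand finite_expand)
  have simple: "s \<noteq> t" "(t, s) \<notin> ?A" if "(s, t) \<in> ?A" for s t
    using expand_simple[of "(Vert_a, Vert_b)" s t n \<omega>] that by (simp_all add: arcs_eq_expand)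
  have "{y. {x, y} \<in> graph n \<omega>} = {t. (x, t) \<in> ?A} \<union> {s. (s, x) \<in> ?A}"
    by (force simp: graph_def doubleton_eq_iff)
  moreover have "{t. (x, t) \<in> ?A} \<inter> {s. (s, x) \<in> ?A} = {}"
    using simple by blast
  moreover have "finite {t. (x, t) \<in> ?A}"
    by (rule finite_subset[OF _ finite_imageI[OF fin, of snd]]) force
  moreover have "finite {s. (s, x) \<in> ?A}"
    by (rule finite_subset[OF _ finite_imageI[OF fin, of fst]]) force
  ultimately have "(\<Sum>y | {x, y} \<in> graph n \<omega>. v x - v y) =
      (\<Sum>t | (x, t) \<in> ?A. v x - v t) + (\<Sum>s | (s, x) \<in> ?A. v x - v s)"
    by (simp add: sum.union_disjoint)
  also have "(\<Sum>t | (x, t) \<in> ?A. v x - v t) = (\<Sum>(s, t)\<in>{a\<in>?A. fst a = x}. v s - v t)"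
    by (rule sum.reindex_bij_witness[of _ snd "\<lambda>t. (x, t)"]) auto
  also have "\<dots> = (\<Sum>(s, t)\<in>?A. if s = x then v s - v t else 0)"
    using fin by (subst sum.inter_filter) (auto intro!: sum.cong)
  also have "(\<Sum>s | (s, x) \<in> ?A. v x - v s) = (\<Sum>(s, t)\<in>{a\<in>?A. snd a = x}. v t - v s)"
    by (rule sum.reindex_bij_witness[of _ fst "\<lambda>s. (s, x)"]) auto
  also have "\<dots> = (\<Sum>(s, t)\<in>?A. if t = x then v t - v s else 0)"
    using fin by (subst sum.inter_filter) (auto intro!: sum.cong)
  finally show ?thesis
    by (simp add: current_def sum.distrib case_prod_unfold)
qed

text \<open>Ensures that both terminals are vertices of the graph, so that the source and sink
  conditions are really imposed.\<close>

lemma ex_arc_at_ends: "(\<exists>t. (fst e, t) \<in> expand n \<omega> e) \<and> (\<exists>s. (s, snd e) \<in> expand n \<omega> e)"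
proof (induction n arbitrary: e)
  case 0
  show ?case by (cases e) auto
next
  case (Suc n)
  obtain u w where e: "e = (u, w)" by (cases e)
  have "(u, Mid u w False) \<in> children \<omega> e" "(Mid u w False, w) \<in> children \<omega> e"
    by (auto simp: e children_def)
  then show ?case
    using Suc[of "(u, Mid u w False)"] Suc[of "(Mid u w False, w)"] unfolding e expand.simps fst_conv snd_conv
    by blast
qed

text \<open>Once the interior is balanced, the terminal currents are plus and minus the potential
  difference divided by \<open>res\<close>, so unit current fixes that difference.\<close>

lemma unit_current_potential_graph_iff:
  "unit_current_potential (graph n \<omega>) Vert_a Vert_b v \<longleftrightarrow>
    (\<forall>x\<in>interior_vertices (Vert_a, Vert_b). current (arcs n \<omega>) v x = 0) \<and>
    v Vert_a - v Vert_b = res n \<omega> (Vert_a, Vert_b)"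
proof -
  let ?e = "(Vert_a, Vert_b)" and ?c = "current (arcs n \<omega>) v"
  have ends: "s \<in> \<Union> (graph n \<omega>)" "t \<in> \<Union> (graph n \<omega>)" if "(s, t) \<in> arcs n \<omega>" for s t
  proof -
    have "{s, t} \<in> graph n \<omega>"
      unfolding graph_def using that by (rule rev_image_eqI) simp
    then show "s \<in> \<Union> (graph n \<omega>)" "t \<in> \<Union> (graph n \<omega>)" by auto
  qed
  have U: "x \<in> vertices ?e" if "x \<in> \<Union> (graph n \<omega>)" for x
    using that expand_vertices[of _ _ n \<omega> ?e] by (auto simp: graph_def arcs_eq_expand)
  have ab: "Vert_a \<in> \<Union> (graph n \<omega>)" "Vert_b \<in> \<Union> (graph n \<omega>)"
    using ex_arc_at_ends[of ?e n \<omega>] ends unfolding arcs_eq_expand fst_conv snd_conv by blast+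
  have int: "x \<noteq> Vert_a" "x \<noteq> Vert_b" if "x \<in> interior_vertices ?e" for x
    using that by (auto simp: interior_vertices_def)
  have out: "?c x = 0" if "x \<notin> \<Union> (graph n \<omega>)" for x
  proof -
    have "(x, t) \<notin> arcs n \<omega>" "(t, x) \<notin> arcs n \<omega>" for t
      using that ends by blast+
    then show ?thesis unfolding current_def by (intro sum.neutral) auto
  qed
  have "unit_current_potential (graph n \<omega>) Vert_a Vert_b v \<longleftrightarrow>
      (\<forall>x\<in>interior_vertices ?e. ?c x = 0) \<and> ?c Vert_a = 1 \<and> ?c Vert_b = -1"
    (is "_ \<longleftrightarrow> ?K")
  proof
    assume ?K
    then show "unit_current_potential (graph n \<omega>) Vert_a Vert_b v"
      unfolding unit_current_potential_def neighbour_sum_eq_current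
      using U int by (auto simp: vertices_def)
  next
    assume "unit_current_potential (graph n \<omega>) Vert_a Vert_b v"
    then have K: "?c x = (if x = Vert_a then 1 else if x = Vert_b then - 1 else 0)"
      if "x \<in> \<Union> (graph n \<omega>)" for x
      using that unfolding unit_current_potential_def neighbour_sum_eq_current by blast
    have "?c x = 0" if "x \<in> interior_vertices ?e" for x
      using K[of x] out[of x] int[OF that] by (cases "x \<in> \<Union> (graph n \<omega>)") auto
    then show ?K
      using K[OF ab(1)] K[OF ab(2)] by simp
  qed
  also have "\<dots> \<longleftrightarrow> (\<forall>x\<in>interior_vertices ?e. ?c x = 0) \<and> v Vert_a - v Vert_b = res n \<omega> ?e"
  proof (rule conj_cong[OF refl])
    assume "\<forall>x\<in>interior_vertices ?e. ?c x = 0"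
    then have "?c Vert_a = (v Vert_a - v Vert_b) / res n \<omega> ?e"
      "?c Vert_b = (v Vert_b - v Vert_a) / res n \<omega> ?e"
      using current_through_expand[of ?e n \<omega> v] by (simp_all add: arcs_eq_expand)
    then show "?c Vert_a = 1 \<and> ?c Vert_b = - 1 \<longleftrightarrow> v Vert_a - v Vert_b = res n \<omega> ?e"
      using res_pos[of n \<omega> ?e] by (auto simp: divide_eq_eq)
  qed
  finally show ?thesis .
qed

text \<open>The description by \<open>THE\<close> needs a potential, built from terminal values
  \<open>res\<close> and 0, and uniqueness of the difference, given by the preceding
  equivalence.\<close>

lemma R_eq_res: "R n \<omega> = res n \<omega> (Vert_a, Vert_b)"
proof -
  let ?e = "(Vert_a, Vert_b)"
  obtain v where v: "\<And>x. x \<notin> interior_vertices ?e \<Longrightarrow> v x = (if x = Vert_a then res n \<omega> ?e else 0)"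
    "\<And>x. x \<in> interior_vertices ?e \<Longrightarrow> current (expand n \<omega> ?e) v x = 0"
    using ex_potential[of ?e "\<lambda>x. if x = Vert_a then res n \<omega> ?e else 0" n \<omega>] by auto
  have "Vert_a \<notin> interior_vertices ?e" "Vert_b \<notin> interior_vertices ?e"
    by (auto simp: interior_vertices_def)
  then have "v Vert_a = res n \<omega> ?e" "v Vert_b = 0"
    using v(1) by simp_all
  with v(2) have "unit_current_potential (graph n \<omega>) Vert_a Vert_b v"
    by (simp add: unit_current_potential_graph_iff arcs_eq_expand)
  then show ?thesis
    unfolding R_def eff_resistance_def
    by (intro the_equality) (metis unit_current_potential_graph_iff)+
qed

section \<open>The recursive law of the resistance\<close>

text \<open>An expectation without a measure. Comparing functions only at positive arguments in
  \<open>mono\<close> expresses that the law is carried by the positive reals.\<close>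

locale expectation_functional =
  fixes E :: "(real \<Rightarrow> real) \<Rightarrow> real"
  assumes add: "E (\<lambda>x. f x + g x) = E f + E g"
    and scale: "E (\<lambda>x. c * f x) = c * E f"
    and one: "E (\<lambda>x. 1) = 1"
    and mono: "(\<And>x. 0 < x \<Longrightarrow> f x \<le> g x) \<Longrightarrow> E f \<le> E g"
begin

lemma const: "E (\<lambda>x. c) = c"
  using scale[of c "\<lambda>_. 1"] one by simp

lemma scale_right: "E (\<lambda>x. f x * c) = E f * c"
  using scale[of c f] by (simp add: mult.commute)

lemma diff: "E (\<lambda>x. f x - g x) = E f - E g"
  using add[of f "\<lambda>x. - 1 * g x"] scale[of "- 1" g] by simp

end

text \<open>Nesting \<open>E\<close> encodes independence of the two summands.\<close>

definition sum_law :: "((real \<Rightarrow> real) \<Rightarrow> real) \<Rightarrow> (real \<Rightarrow> real) \<Rightarrow> real" where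
  "sum_law E f = E (\<lambda>x. E (\<lambda>y. f (x + y)))"

context expectation_functional
begin

lemma expectation_functional_sum_law: "expectation_functional (sum_law E)"
proof
  show "sum_law E f \<le> sum_law E g" if "\<And>x. 0 < x \<Longrightarrow> f x \<le> g x" for f g
    unfolding sum_law_def by (intro mono that) simp
qed (simp_all add: sum_law_def add scale one const)

lemma sum_law_mean: "sum_law E (\<lambda>x. x) = 2 * E (\<lambda>x. x)"
  by (simp add: sum_law_def add const)

lemma sum_law_second_moment: "sum_law E (\<lambda>x. x\<^sup>2) = 2 * E (\<lambda>x. x\<^sup>2) + 2 * (E (\<lambda>x. x))\<^sup>2"
  by (simp add: sum_law_def power2_sum add const scale scale_right power2_eq_square algebra_simps)

end

text \<open>
  The law of \<open>res n\<close>, with \<open>q\<close> the probability of a diamond, encoded as the functional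
  \<open>f \<mapsto> E (f (res n))\<close>.  The law has finite support, so \<open>f\<close> need not be measurable.
\<close>

primrec res_law :: "real \<Rightarrow> nat \<Rightarrow> (real \<Rightarrow> real) \<Rightarrow> real" where
  "res_law q 0 f = f 1"
| "res_law q (Suc n) f =
     q * sum_law (res_law q n) (\<lambda>x. sum_law (res_law q n) (\<lambda>y. f (parallel x y))) +
     (1 - q) * sum_law (res_law q n) f"

lemma parallel_commute: "parallel x y = parallel y x"
  by (simp add: parallel_def add.commute mult.commute)

lemma parallel_scale: "c \<noteq> 0 \<Longrightarrow> parallel (c * x) (c * y) = c * parallel x y"
  by (simp add: parallel_def flip: distrib_left)

lemma expectation_functional_res_law:
  assumes "0 \<le> q" "q \<le> 1"
  shows "expectation_functional (res_law q n)"
proof (induction n)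
  case 0
  then show ?case by unfold_locales simp_all
next
  case (Suc n)
  then interpret expectation_functional "res_law q n" .
  interpret S: expectation_functional "sum_law (res_law q n)"
    by (rule expectation_functional_sum_law)
  show ?case
  proof
    fix f g :: "real \<Rightarrow> real"
    assume "\<And>x. 0 < x \<Longrightarrow> f x \<le> g x"
    then show "res_law q (Suc n) f \<le> res_law q (Suc n) g"
      using assms by (auto intro!: add_mono mult_left_mono S.mono parallel_pos)
  qed (simp_all add: S.add S.scale S.one algebra_simps)
qed

subsection \<open>Growth of the mean\<close>

text \<open>
  The lower bound is tight where \<open>l (x + y) = 1\<close>, and for independent \<open>x\<close> and \<open>y\<close> its expectation
  involves only first and second moments.
\<close>

lemma parallel_ge:
  assumes "0 < x" "0 < y"
  shows "2 * l * (x * y) - l\<^sup>2 * (x\<^sup>2 * y + x * y\<^sup>2) \<le> parallel x y"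
proof -
  have "parallel x y - (2 * l * (x * y) - l\<^sup>2 * (x\<^sup>2 * y + x * y\<^sup>2)) =
      x * y / (x + y) * (1 - l * (x + y))\<^sup>2"
    using assms by (simp add: parallel_def field_simps power2_eq_square)
  moreover have "0 \<le> x * y / (x + y) * (1 - l * (x + y))\<^sup>2"
    using assms by simp
  ultimately show ?thesis by linarith
qed

text \<open>AM-GM in the form \<open>4 * (x * y) \<le> (x + y)\<^sup>2\<close>. The product on the
  right has a factorizing expectation under independence.\<close>

lemma parallel_sq_le:
  assumes "0 < x" "0 < y"
  shows "(parallel x y)\<^sup>2 \<le> x * y / 4"
proof -
  have "4 * (x * y) \<le> (x + y)\<^sup>2"
    using sum_squares_bound[of x y] by (simp add: power2_sum)
  then have "x * y * (4 * (x * y)) \<le> x * y * (x + y)\<^sup>2"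
    using assms by (intro mult_left_mono) auto
  then have "(x * y)\<^sup>2 \<le> x * y / 4 * (x + y)\<^sup>2"
    by (simp add: power2_eq_square[of "x * y"])
  then show ?thesis
    using assms by (simp add: parallel_def power_divide pos_divide_le_eq)
qed

lemma res_law_growth:
  assumes q: "0 \<le> q" "q \<le> 1 / 2"
  shows "1 \<le> res_law q n (\<lambda>x. x)"
    and "res_law q n (\<lambda>x. x\<^sup>2) \<le> 2 * (res_law q n (\<lambda>x. x))\<^sup>2"
    and "(2 - 4 / 3 * q) * res_law q n (\<lambda>x. x) \<le> res_law q (Suc n) (\<lambda>x. x)"
proof -
  have step: "(2 - 4 / 3 * q) * res_law q n (\<lambda>x. x) \<le> res_law q (Suc n) (\<lambda>x. x)"
    and step2: "res_law q (Suc n) (\<lambda>x. x\<^sup>2) \<le> (6 - 5 * q) * (res_law q n (\<lambda>x. x))\<^sup>2"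
    if m1: "1 \<le> res_law q n (\<lambda>x. x)"
      and s_le: "res_law q n (\<lambda>x. x\<^sup>2) \<le> 2 * (res_law q n (\<lambda>x. x))\<^sup>2" for n
  proof -
    define m s where "m = res_law q n (\<lambda>x. x)" and "s = res_law q n (\<lambda>x. x\<^sup>2)"
    have m: "1 \<le> m" and s: "s \<le> 2 * m\<^sup>2" using m1 s_le by (simp_all add: m_def s_def)
    interpret expectation_functional "res_law q n"
      using q by (intro expectation_functional_res_law) auto
    let ?S = "sum_law (res_law q n)"
    interpret S: expectation_functional ?S
      by (rule expectation_functional_sum_law)
    have mean: "?S (\<lambda>x. x) = 2 * m" by (simp add: m_def sum_law_mean)
    have second: "?S (\<lambda>x. x\<^sup>2) = 2 * s + 2 * m\<^sup>2" by (simp add: m_def s_def sum_law_second_moment)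
    have "2 / 3 * m \<le> ?S (\<lambda>x. ?S (\<lambda>y. parallel x y))"
    proof -
      \<comment> \<open>the optimal choice in the extremal case \<open>s = 2 * m\<^sup>2\<close>\<close>
      define l where "l = 1 / (6 * m)"
      have "?S (\<lambda>x. ?S (\<lambda>y. 2 * l * (x * y) - l\<^sup>2 * (x\<^sup>2 * y + x * y\<^sup>2))) =
          2 * l * (2 * m * (2 * m)) - l\<^sup>2 * (2 * ((2 * s + 2 * m\<^sup>2) * (2 * m)))"
        by (simp only: S.diff S.add S.scale S.scale_right mean second) (simp add: algebra_simps)
      \<comment> \<open>The second moment \<open>2 * s + 2 * m\<^sup>2\<close> of a branch is at
        most \<open>6 * m\<^sup>2\<close>.\<close>
      also have "\<dots> \<ge> 2 * l * (2 * m * (2 * m)) - l\<^sup>2 * (2 * ((6 * m\<^sup>2) * (2 * m)))"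
        using s m by (intro diff_mono mult_left_mono mult_right_mono order.refl) auto
      also have "2 * l * (2 * m * (2 * m)) - l\<^sup>2 * (2 * ((6 * m\<^sup>2) * (2 * m))) = 2 / 3 * m"
        using m by (simp add: l_def power2_eq_square field_simps)
      also have "?S (\<lambda>x. ?S (\<lambda>y. 2 * l * (x * y) - l\<^sup>2 * (x\<^sup>2 * y + x * y\<^sup>2))) \<le>
          ?S (\<lambda>x. ?S (\<lambda>y. parallel x y))"
        by (intro S.mono parallel_ge)
      finally show ?thesis by simp
    qed
    then have "q * (2 / 3 * m) \<le> q * ?S (\<lambda>x. ?S (\<lambda>y. parallel x y))"
      using q by (intro mult_left_mono) auto
    then show "(2 - 4 / 3 * q) * res_law q n (\<lambda>x. x) \<le> res_law q (Suc n) (\<lambda>x. x)"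
      by (simp add: mean flip: m_def) (simp add: algebra_simps)
    have "?S (\<lambda>x. ?S (\<lambda>y. (parallel x y)\<^sup>2)) \<le> ?S (\<lambda>x. ?S (\<lambda>y. (1 / 4 * x) * y))"
      by (intro S.mono) (use parallel_sq_le in force)
    also have "\<dots> = m\<^sup>2"
      by (simp only: S.scale S.scale_right mean) (simp add: power2_eq_square)
    finally have "q * ?S (\<lambda>x. ?S (\<lambda>y. (parallel x y)\<^sup>2)) \<le> q * m\<^sup>2"
      using q by (intro mult_left_mono) auto
    \<comment> \<open>The factor \<open>6 - 5 * q\<close> is the mixture of 1 for a diamond and 6
      for a series.\<close>
    moreover have "(1 - q) * (2 * s + 2 * m\<^sup>2) \<le> (1 - q) * (6 * m\<^sup>2)"
      using q s by (intro mult_left_mono) auto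
    ultimately show "res_law q (Suc n) (\<lambda>x. x\<^sup>2) \<le> (6 - 5 * q) * (res_law q n (\<lambda>x. x))\<^sup>2"
      by (simp add: second flip: m_def) (simp add: algebra_simps)
  qed
  have inv: "1 \<le> res_law q n (\<lambda>x. x) \<and> res_law q n (\<lambda>x. x\<^sup>2) \<le> 2 * (res_law q n (\<lambda>x. x))\<^sup>2" for n
  proof (induction n)
    case (Suc n)
    define m m' where "m = res_law q n (\<lambda>x. x)" and "m' = res_law q (Suc n) (\<lambda>x. x)"
    have m: "1 \<le> m" "(2 - 4 / 3 * q) * m \<le> m'"
      using Suc step by (simp_all only: m_def m'_def)
    have "1 * 1 \<le> (2 - 4 / 3 * q) * m"
      using q m by (intro mult_mono) auto
    then have "1 \<le> m'" using m by linarith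
    \<comment> \<open>This product plus 1 is 18 times
      \<open>2 * (2 - 4 / 3 * q)\<^sup>2 - (6 - 5 * q)\<close>.\<close>
    have "0 \<le> (1 - 2 * q) * (35 - 32 * q)"
      using q by (intro mult_nonneg_nonneg) auto
    then have coeff: "6 - 5 * q \<le> 2 * (2 - 4 / 3 * q)\<^sup>2"
      by (simp add: power2_eq_square field_simps)
    have "res_law q (Suc n) (\<lambda>x. x\<^sup>2) \<le> (6 - 5 * q) * m\<^sup>2"
      unfolding m_def by (rule step2) (use Suc in blast)+
    also have "\<dots> \<le> 2 * (2 - 4 / 3 * q)\<^sup>2 * m\<^sup>2"
      using coeff by (intro mult_right_mono) auto
    also have "\<dots> = 2 * ((2 - 4 / 3 * q) * m)\<^sup>2"
      by (simp add: power_mult_distrib)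
    also have "\<dots> \<le> 2 * m'\<^sup>2"
      using m q by (intro mult_left_mono power_mono) auto
    finally have "res_law q (Suc n) (\<lambda>x. x\<^sup>2) \<le> 2 * m'\<^sup>2" .
    with \<open>1 \<le> m'\<close> show ?case by (simp only: m'_def)
  qed simp
  show "1 \<le> res_law q n (\<lambda>x. x)" "res_law q n (\<lambda>x. x\<^sup>2) \<le> 2 * (res_law q n (\<lambda>x. x))\<^sup>2"
    "(2 - 4 / 3 * q) * res_law q n (\<lambda>x. x) \<le> res_law q (Suc n) (\<lambda>x. x)"
    using inv step by blast+
qed

subsection \<open>Submultiplicativity of the mean\<close>

text \<open>The test functions of the increasing concave order: one law lies below another if it
  gives each of them a smaller expectation.\<close>

definition inc_concave :: "(real \<Rightarrow> real) \<Rightarrow> bool" where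
  "inc_concave f \<longleftrightarrow> mono_on {0<..} f \<and> concave_on {0<..} f"

lemma inc_concave_iff:
  "inc_concave f \<longleftrightarrow> (\<forall>x y. 0 < x \<longrightarrow> x \<le> y \<longrightarrow> f x \<le> f y) \<and>
    (\<forall>x y u v. 0 < x \<longrightarrow> 0 < y \<longrightarrow> 0 \<le> u \<longrightarrow> 0 \<le> v \<longrightarrow> u + v = 1 \<longrightarrow>
      u * f x + v * f y \<le> f (u * x + v * y))"
  by (force simp: inc_concave_def mono_on_def concave_on_iff)

text \<open>Monotonicity of \<open>f\<close> is what carries the concavity inequality of
  \<open>g\<close> through \<open>f\<close>.\<close>

lemma inc_concave_compose:
  assumes f: "inc_concave f" and g: "inc_concave g" and pos: "\<And>x. 0 < x \<Longrightarrow> 0 < g x"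
  shows "inc_concave (\<lambda>x. f (g x))"
  unfolding inc_concave_iff
proof (intro conjI allI impI)
  fix x y u v :: real
  assume *: "0 < x" "0 < y" "0 \<le> u" "0 \<le> v" "u + v = 1"
  then have "u * f (g x) + v * f (g y) \<le> f (u * g x + v * g y)"
    using f pos by (simp add: inc_concave_iff)
  also have "\<dots> \<le> f (g (u * x + v * y))"
  proof -
    have "0 < u * g x + v * g y"
      using * pos[of x] pos[of y] by (cases "u = 0") (auto intro: add_pos_nonneg)
    then show ?thesis using f g * by (simp add: inc_concave_iff)
  qed
  finally show "u * f (g x) + v * f (g y) \<le> f (g (u * x + v * y))" .
qed (use f g pos in \<open>simp add: inc_concave_iff\<close>)

lemma inc_concave_add_const: "inc_concave (\<lambda>x. x + c)"
proof -
  have "u * (x + c) + v * (y + c) = u * x + v * y + c" if "u + v = 1" for u v x y :: real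
  proof -
    have "u * (x + c) + v * (y + c) = u * x + v * y + (u + v) * c" by (simp add: algebra_simps)
    then show ?thesis using that by simp
  qed
  then show ?thesis by (simp add: inc_concave_iff)
qed

text \<open>With \<open>c\<close> fixed, the value is \<open>c\<close> minus a positive multiple of
  \<open>inverse (x + c)\<close>, which is decreasing and convex.\<close>

lemma inc_concave_parallel:
  assumes c: "0 < c"
  shows "inc_concave (\<lambda>x. parallel x c)"
  unfolding inc_concave_iff
proof (intro conjI allI impI)
  have eq: "parallel x c = c - c\<^sup>2 * inverse (x + c)" if "0 < x" for x
    using that c by (simp add: parallel_def field_simps power2_eq_square)
  show "parallel x c \<le> parallel y c" if "0 < x" "x \<le> y" for x y
    using that c by (simp add: eq le_imp_inverse_le)
  fix x y u v :: real
  assume *: "0 < x" "0 < y" "0 \<le> u" "0 \<le> v" "u + v = 1"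
  have "0 < u * x + v * y"
    using * by (cases "u = 0") (auto intro: add_pos_nonneg)
  have "inverse (u * (x + c) + v * (y + c)) \<le> u * inverse (x + c) + v * inverse (y + c)"
    using convex_on_inverse[of "{0<..}"] * c by (auto simp: convex_on_def)
  moreover have "u * (x + c) + v * (y + c) = u * x + v * y + (u + v) * c"
    by (simp add: algebra_simps)
  ultimately have "c\<^sup>2 * inverse (u * x + v * y + c) \<le> c\<^sup>2 * (u * inverse (x + c) + v * inverse (y + c))"
    using * by (intro mult_left_mono) auto
  moreover have "u * (c - c\<^sup>2 * inverse (x + c)) + v * (c - c\<^sup>2 * inverse (y + c)) =
      (u + v) * c - c\<^sup>2 * (u * inverse (x + c) + v * inverse (y + c))"
    by (simp add: algebra_simps)
  ultimately show "u * parallel x c + v * parallel y c \<le> parallel (u * x + v * y) c"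
    using * \<open>0 < u * x + v * y\<close> by (simp add: eq)
qed

context expectation_functional
begin

text \<open>Lets a partly integrated test function serve again as a test function when several
  arguments are replaced in turn.\<close>

lemma inc_concave_expectation:
  assumes "\<And>y. 0 < y \<Longrightarrow> inc_concave (\<lambda>x. h x y)"
  shows "inc_concave (\<lambda>x. E (h x))"
  unfolding inc_concave_iff
proof (intro conjI allI impI)
  show "E (h x) \<le> E (h y)" if "0 < x" "x \<le> y" for x y
    using that assms by (intro mono) (simp add: inc_concave_iff)
  fix x y u v :: real
  assume "0 < x" "0 < y" "0 \<le> u" "0 \<le> v" "u + v = 1"
  then have "E (\<lambda>z. u * h x z + v * h y z) \<le> E (h (u * x + v * y))"
    using assms by (intro mono) (simp add: inc_concave_iff)
  then show "u * E (h x) + v * E (h y) \<le> E (h (u * x + v * y))"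
    by (simp add: add scale)
qed

text \<open>Integrate a supporting line of \<open>f\<close> at the mean; its slope term has
  expectation zero.\<close>

lemma jensen:
  assumes f: "inc_concave f" and m: "0 < E (\<lambda>x. x)"
  shows "E f \<le> f (E (\<lambda>x. x))"
proof -
  let ?m = "E (\<lambda>x. x)"
  have "convex_on {0<..} (\<lambda>x. - f x)"
    using f by (simp add: inc_concave_def concave_on_def)
  then obtain c where c: "- f y \<ge> - f ?m + c * (y - ?m)" if "0 < y" for y
    using convex_le_Inf_differential[of "{0<..}" "\<lambda>x. - f x" ?m] m by (auto simp: interior_open)
  have "E f \<le> E (\<lambda>y. f ?m - c * (y - ?m))"
    using c by (intro mono) force
  also have "\<dots> = f ?m"
    by (simp only: diff scale const) simp
  finally show ?thesis .
qed

end

text \<open>The summands are replaced one at a time: with the other one frozen, \<open>f\<close>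
  becomes a shifted function that is still increasing and concave.\<close>

lemma sum_law_le:
  assumes "expectation_functional E" "expectation_functional E'" and c: "0 < c"
    and le: "\<And>f. inc_concave f \<Longrightarrow> E f \<le> E' (\<lambda>x. f (c * x))"
    and f: "inc_concave f"
  shows "sum_law E f \<le> sum_law E' (\<lambda>x. f (c * x))"
proof -
  interpret E: expectation_functional E by fact
  interpret E': expectation_functional E' by fact
  have shift: "inc_concave (\<lambda>x. f (x + a))" if "0 < a" for a
    using inc_concave_compose[OF f inc_concave_add_const] that by simp
  have "sum_law E f \<le> E (\<lambda>x. E' (\<lambda>y. f (x + c * y)))"
    unfolding sum_law_def using le[OF shift] by (intro E.mono) (simp add: add.commute)
  also have "\<dots> \<le> E' (\<lambda>x. E' (\<lambda>y. f (c * x + c * y)))"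
    using c by (intro le E'.inc_concave_expectation shift) simp
  finally show ?thesis by (simp add: sum_law_def distrib_left)
qed

text \<open>Giving each edge of generation \<open>n\<close> the constant mean resistance of
  \<open>k\<close> further steps can only increase the law in this order. Jensen is the base case;
  the step uses that series and parallel connection are increasing, concave in each argument and
  homogeneous.\<close>

lemma res_law_add_le:
  assumes q: "0 \<le> q" "q \<le> 1 / 2" and f: "inc_concave f"
  shows "res_law q (n + k) f \<le> res_law q n (\<lambda>x. f (res_law q k (\<lambda>x. x) * x))"
  using f
proof (induction n arbitrary: f)
  case 0
  interpret expectation_functional "res_law q k"
    using q by (intro expectation_functional_res_law) auto
  show ?case
    using jensen[OF 0] res_law_growth(1)[OF q, of k] by simp
next
  case (Suc n)
  define c where "c = res_law q k (\<lambda>x. x)"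
  have c: "0 < c" using res_law_growth(1)[OF q, of k] by (simp add: c_def)
  have law: "expectation_functional (res_law q n)" for n
    using q by (intro expectation_functional_res_law) auto
  let ?S = "sum_law (res_law q (n + k))" and ?S' = "sum_law (res_law q n)"
  interpret S: expectation_functional ?S
    by (intro expectation_functional.expectation_functional_sum_law law)
  interpret S': expectation_functional ?S'
    by (intro expectation_functional.expectation_functional_sum_law law)
  have le: "?S g \<le> ?S' (\<lambda>x. g (c * x))" if "inc_concave g" for g
    using sum_law_le[OF law law c _ that] Suc.IH by (simp add: c_def)
  have par: "inc_concave (\<lambda>x. f (parallel x a))" if "0 < a" for a
    using inc_concave_compose[OF Suc.prems inc_concave_parallel] that parallel_pos by simp
  have "?S (\<lambda>x. ?S (\<lambda>y. f (parallel x y))) \<le> ?S (\<lambda>x. ?S' (\<lambda>y. f (parallel x (c * y))))"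
    using le[OF par] by (intro S.mono) (simp add: parallel_commute)
  also have "\<dots> \<le> ?S' (\<lambda>x. ?S' (\<lambda>y. f (parallel (c * x) (c * y))))"
    using c by (intro le S'.inc_concave_expectation par) simp
  finally have "?S (\<lambda>x. ?S (\<lambda>y. f (parallel x y))) \<le> ?S' (\<lambda>x. ?S' (\<lambda>y. f (c * parallel x y)))"
    using c by (simp add: parallel_scale)
  then show ?case
    using le[OF Suc.prems] q by (auto intro!: add_mono mult_left_mono simp flip: c_def)
qed

lemma res_law_mean_submult:
  assumes q: "0 \<le> q" "q \<le> 1 / 2"
  shows "res_law q (n + k) (\<lambda>x. x) \<le> res_law q n (\<lambda>x. x) * res_law q k (\<lambda>x. x)"
proof -
  interpret expectation_functional "res_law q n"
    using q by (intro expectation_functional_res_law) auto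
  show ?thesis
    using res_law_add_le[OF q, of "\<lambda>x. x" n k] inc_concave_add_const[of 0]
    by (simp add: scale mult.commute[of "res_law q n _"])
qed

section \<open>Existence of the growth rate and its lower bound\<close>

lemma subadditive_imp_convergent:
  fixes u :: "nat \<Rightarrow> real"
  assumes subadd: "\<And>m n. u (m + n) \<le> u m + u n" and nonneg: "\<And>n. 0 \<le> u n"
  shows "convergent (\<lambda>n. u n / real n)"
proof -
  \<comment> \<open>Fekete's argument: the infimum is the limit, and nonnegativity keeps it
    finite.\<close>
  define L where "L = (INF n\<in>{0<..}. u n / real n)"
  have bdd: "bdd_below ((\<lambda>n. u n / real n) ` {0<..})"
    by (rule bdd_belowI[of _ 0]) (auto simp: nonneg)
  have "(\<lambda>n. u n / real n) \<longlonglongrightarrow> L"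
  proof (rule LIMSEQ_I)
    fix \<epsilon> :: real
    assume \<epsilon>: "0 < \<epsilon>"
    then have "\<exists>k\<in>{0<..}. u k / real k < L + \<epsilon> / 2"
      by (intro iffD1[OF cINF_less_iff[OF _ bdd]]) (simp_all flip: L_def)
    then obtain k where k: "0 < k" "u k / real k < L + \<epsilon> / 2"
      by auto
    \<comment> \<open>A common bound for \<open>u\<close> at all remainders modulo
      \<open>k\<close>.\<close>
    define C where "C = (\<Sum>r<k. u r)"
    \<comment> \<open>The summand \<open>u 0\<close> covers \<open>d = 0\<close>.\<close>
    have mult: "u (d * k) \<le> real d * u k + u 0" for d
    proof (induction d)
      case (Suc d)
      then show ?case using subadd[of k "d * k"] by (simp add: algebra_simps)
    qed simp
    have "eventually (\<lambda>n. (C + u 0) / real n < \<epsilon> / 2) sequentially"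
      using \<epsilon> by real_asymp
    then obtain N where N: "\<And>n. N \<le> n \<Longrightarrow> (C + u 0) / real n < \<epsilon> / 2"
      by (auto simp: eventually_sequentially)
    have "norm (u n / real n - L) < \<epsilon>" if n: "max N 1 \<le> n" for n
    proof -
      let ?d = "n div k" and ?r = "n mod k"
      have "u ?r \<le> C"
        unfolding C_def using k nonneg by (intro member_le_sum) auto
      then have "u n \<le> real ?d * u k + (C + u 0)"
        using subadd[of "?d * k" ?r] mult[of ?d] by simp
      also have "real ?d * u k = real (?d * k) * (u k / real k)"
        using k by simp
      also have "\<dots> \<le> real n * (u k / real k)"
        using nonneg by (intro mult_right_mono) (simp_all del: of_nat_mult)
      finally have "u n / real n \<le> (real n * (u k / real k) + (C + u 0)) / real n"
        by (intro divide_right_mono) simp_all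
      then have "u n / real n \<le> u k / real k + (C + u 0) / real n"
        using n by (simp add: add_divide_distrib)
      moreover have "L \<le> u n / real n"
        unfolding L_def using n by (intro cINF_lower[OF bdd]) auto
      moreover have "(C + u 0) / real n < \<epsilon> / 2"
        using N n by simp
      ultimately have "0 \<le> u n / real n - L" "u n / real n - L < \<epsilon>"
        using k(2) by linarith+
      then show ?thesis by simp
    qed
    then show "\<exists>N. \<forall>n\<ge>N. norm (u n / real n - L) < \<epsilon>" by blast
  qed
  then show ?thesis by (rule convergentI)
qed

text \<open>\<open>lim\<close> is informative only for convergent sequences, so submultiplicativity
  first yields convergence; then the geometric lower bound passes to the limit.\<close>

lemma lim_ln_mean_ge:
  assumes q: "0 \<le> q" "q \<le> 1 / 2"
  shows "ln (2 - 4 / 3 * q) \<le> lim (\<lambda>n. ln (res_law q n (\<lambda>x. x)) / real n)"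
proof (rule LIMSEQ_le_const)
  let ?m = "\<lambda>n. res_law q n (\<lambda>x. x)"
  note m = res_law_growth(1)[OF q]
  have m_pos: "0 < ?m n" for n using m[of n] by linarith
  have "ln (?m (n + k)) \<le> ln (?m n) + ln (?m k)" for n k
    using res_law_mean_submult[OF q, of n k] m_pos by (simp flip: ln_mult_pos)
  moreover have "0 \<le> ln (?m n)" for n using m by simp
  ultimately have "convergent (\<lambda>n. ln (?m n) / real n)" by (rule subadditive_imp_convergent)
  then show "(\<lambda>n. ln (?m n) / real n) \<longlonglongrightarrow> lim (\<lambda>n. ln (?m n) / real n)"
    by (simp add: convergent_LIMSEQ_iff)
  have pow: "(2 - 4 / 3 * q) ^ n \<le> ?m n" for n
  proof (induction n)
    case (Suc n)
    have "(2 - 4 / 3 * q) ^ Suc n \<le> (2 - 4 / 3 * q) * ?m n"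
      using Suc q by (simp add: mult_left_mono)
    also have "\<dots> \<le> ?m (Suc n)" by (rule res_law_growth(3)[OF q])
    finally show ?case .
  qed simp
  have "ln (2 - 4 / 3 * q) \<le> ln (?m n) / real n" if "1 \<le> n" for n
  proof -
    have pos: "0 < 2 - 4 / 3 * q" using q by linarith
    then have "ln ((2 - 4 / 3 * q) ^ n) \<le> ln (?m n)"
      using pow m_pos by (intro ln_mono) auto
    then show ?thesis using that pos by (simp add: ln_realpow pos_le_divide_eq mult.commute)
  qed
  then show "\<exists>N. \<forall>n\<ge>N. ln (2 - 4 / 3 * q) \<le> ln (?m n) / real n" by blast
qed

section \<open>The law of the resistance under the coin measure\<close>

text \<open>For finite \<open>A\<close> and boolean coins such an \<open>X\<close> takes finitely
  many values, which replaces measurability arguments.\<close>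

definition determined_by :: "'i set \<Rightarrow> (('i \<Rightarrow> 'a) \<Rightarrow> 'b) \<Rightarrow> bool" where
  "determined_by A X \<longleftrightarrow> (\<forall>\<omega> \<omega>'. (\<forall>i\<in>A. \<omega> i = \<omega>' i) \<longrightarrow> X \<omega> = X \<omega>')"

lemma determined_byD: "determined_by A X \<Longrightarrow> (\<And>i. i \<in> A \<Longrightarrow> \<omega> i = \<omega>' i) \<Longrightarrow> X \<omega> = X \<omega>'"
  by (auto simp: determined_by_def)

lemma determined_by_mono: "determined_by A X \<Longrightarrow> A \<subseteq> B \<Longrightarrow> determined_by B X"
  unfolding determined_by_def by blast

lemma determined_by_compose:
  assumes "determined_by A X"
  shows "determined_by A (\<lambda>\<omega>. h (X \<omega>))"
  unfolding determined_by_def by (intro allI impI arg_cong[where f = h] determined_byD[OF assms]) simp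

lemma determined_by_Pair:
  assumes "determined_by A X" "determined_by B Y"
  shows "determined_by (A \<union> B) (\<lambda>\<omega>. (X \<omega>, Y \<omega>))"
  unfolding determined_by_def
  by (intro allI impI arg_cong2[where f = Pair] determined_byD[OF assms(1)] determined_byD[OF assms(2)]) simp_all

lemma finite_set_Pi_pmf_bool: "finite A \<Longrightarrow> finite (set_pmf (Pi_pmf A False (\<lambda>_. P :: bool pmf)))"
  by (rule finite_subset[OF set_Pi_pmf_subset']) (auto intro: finite_PiE_dflt)

text \<open>\<open>X\<close> is a finite combination of indicators of cylinders, one for each
  assignment on \<open>A\<close>, so the infinite product reduces to a finite one.\<close>

lemma integral_PiM_bool:
  fixes X :: "('i \<Rightarrow> bool) \<Rightarrow> real"
  assumes A: "finite A" and X: "determined_by A X"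
  shows "(LINT \<omega>|PiM UNIV (\<lambda>_. measure_pmf P). X \<omega>) = measure_pmf.expectation (Pi_pmf A False (\<lambda>_. P)) X"
proof -
  let ?M = "PiM UNIV (\<lambda>_ :: 'i. measure_pmf P)"
  interpret product_prob_space "\<lambda>_ :: 'i. measure_pmf P" UNIV
    by (intro product_prob_spaceI measure_pmf.prob_space_axioms)
  \<comment> \<open>Assignments on \<open>A\<close> are represented by functions with the default
    value \<open>False\<close> elsewhere, as in \<open>Pi_pmf\<close>.\<close>
  define G :: "('i \<Rightarrow> bool) set" where "G = PiE_dflt A False (\<lambda>_. UNIV)"
  have G: "finite G" unfolding G_def using A by (intro finite_PiE_dflt) auto
  define C where "C g = {\<omega>\<in>space ?M. \<forall>i\<in>A. \<omega> i \<in> {g i}}" for g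
  have C: "C g \<in> sets ?M" for g
    unfolding C_def using A by (intro sets.sets_Collect_finite_All sets_Collect_single) auto
  have meas: "measure ?M (C g) = pmf (Pi_pmf A False (\<lambda>_. P)) g" if "g \<in> G" for g
  proof -
    have "emeasure ?M (C g) = (\<Prod>i\<in>A. emeasure (measure_pmf P) {g i})"
      unfolding C_def using A by (intro emeasure_PiM_Collect) auto
    also have "\<dots> = ennreal (\<Prod>i\<in>A. pmf P (g i))"
      by (simp add: emeasure_pmf_single prod_ennreal)
    also have "(\<Prod>i\<in>A. pmf P (g i)) = pmf (Pi_pmf A False (\<lambda>_. P)) g"
      using that A by (intro pmf_Pi'[symmetric]) (auto simp: G_def PiE_dflt_def)
    finally show ?thesis by (simp add: measure_def)
  qed
  have X_eq: "X \<omega> = (\<Sum>g\<in>G. X g * indicator (C g) \<omega>)" for \<omega>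
  proof -
    define g where "g i = (i \<in> A \<and> \<omega> i)" for i
    have "g \<in> G" by (auto simp: G_def PiE_dflt_def g_def)
    have "\<omega> \<in> C g' \<longleftrightarrow> g' = g" if "g' \<in> G" for g'
      using that by (auto simp: C_def G_def PiE_dflt_def g_def space_PiM fun_eq_iff)
    then have "(\<Sum>g'\<in>G. X g' * indicator (C g') \<omega>) = (\<Sum>g'\<in>G. if g' = g then X g' else 0)"
      by (intro sum.cong) (auto simp: indicator_def)
    also have "\<dots> = X g" using G \<open>g \<in> G\<close> by simp
    also have "\<dots> = X \<omega>" by (rule determined_byD[OF X]) (simp add: g_def)
    finally show ?thesis ..
  qed
  have "(LINT \<omega>|?M. X \<omega>) = (LINT \<omega>|?M. (\<Sum>g\<in>G. X g * indicator (C g) \<omega>))"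
    by (intro Bochner_Integration.integral_cong refl X_eq)
  also have "\<dots> = (\<Sum>g\<in>G. LINT \<omega>|?M. X g * indicator (C g) \<omega>)"
    using C by (intro Bochner_Integration.integral_sum integrable_mult_right integrable_real_indicator)
      (simp_all add: emeasure_eq_measure)
  also have "\<dots> = (\<Sum>g\<in>G. X g * measure ?M (C g))"
    using C by (simp add: sets.Int_space_eq2)
  also have "\<dots> = (\<Sum>g\<in>G. X g * pmf (Pi_pmf A False (\<lambda>_. P)) g)"
    using meas by simp
  also have "\<dots> = measure_pmf.expectation (Pi_pmf A False (\<lambda>_. P)) X"
    using set_Pi_pmf_subset'[OF A, of False "\<lambda>_. P"] G
    by (subst integral_measure_pmf_real[of G]) (auto simp: G_def PiE_dflt_def)
  finally show ?thesis .
qed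

lemma expectation_pair_pmf_finite:
  fixes f :: "'a \<times> 'b \<Rightarrow> real"
  assumes "finite (set_pmf P)" "finite (set_pmf Q)"
  shows "measure_pmf.expectation (pair_pmf P Q) f =
    measure_pmf.expectation P (\<lambda>x. measure_pmf.expectation Q (\<lambda>y. f (x, y)))"
proof -
  have "pair_pmf P Q = bind_pmf P (\<lambda>x. map_pmf (Pair x) Q)"
    by (simp add: pair_pmf_def map_pmf_def)
  then show ?thesis
    using assms by (simp add: pmf_expectation_bind[of "set_pmf P"] integral_measure_pmf[of "set_pmf P"])
qed

text \<open>Independence of disjoint coin sets: \<open>Y\<close> may be evaluated at an independent
  second sample.\<close>

lemma integral_PiM_disjoint:
  fixes F :: "'a \<Rightarrow> 'b \<Rightarrow> real" and X :: "('i \<Rightarrow> bool) \<Rightarrow> 'a" and P :: "bool pmf"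
  assumes fin: "finite A" "finite B" and disj: "A \<inter> B = {}"
    and X: "determined_by A X" and Y: "determined_by B Y"
  defines "M \<equiv> PiM UNIV (\<lambda>_. measure_pmf P)"
  shows "(LINT \<omega>|M. F (X \<omega>) (Y \<omega>)) = (LINT \<omega>|M. (LINT \<omega>'|M. F (X \<omega>) (Y \<omega>')))"
proof -
  let ?P = "\<lambda>A. Pi_pmf A False (\<lambda>_. P)"
  let ?h = "\<lambda>(f, g) x. if x \<in> A then f x else g x"
  have "determined_by (A \<union> B) (\<lambda>\<omega>. F (X \<omega>) (Y \<omega>))"
    using determined_by_compose[OF determined_by_Pair[OF X Y], of "\<lambda>(x, y). F x y"] by simp
  then have "(LINT \<omega>|M. F (X \<omega>) (Y \<omega>)) = measure_pmf.expectation (?P (A \<union> B)) (\<lambda>\<omega>. F (X \<omega>) (Y \<omega>))"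
    unfolding M_def using fin by (intro integral_PiM_bool) auto
  also have "\<dots> = measure_pmf.expectation (pair_pmf (?P A) (?P B)) (\<lambda>(f, g). F (X (?h (f, g))) (Y (?h (f, g))))"
    using fin disj by (simp add: Pi_pmf_union integral_map_pmf case_prod_unfold)
  also have "(\<lambda>(f, g). F (X (?h (f, g))) (Y (?h (f, g)))) = (\<lambda>(f, g). F (X f) (Y g))"
  proof -
    have "X (?h (f, g)) = X f" "Y (?h (f, g)) = Y g" for f g
      using disj by (auto intro!: determined_byD[OF X] determined_byD[OF Y])
    then show ?thesis by (simp add: fun_eq_iff)
  qed
  also have "measure_pmf.expectation (pair_pmf (?P A) (?P B)) \<dots> =
      measure_pmf.expectation (?P A) (\<lambda>f. measure_pmf.expectation (?P B) (\<lambda>g. F (X f) (Y g)))"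
    using fin by (simp add: expectation_pair_pmf_finite finite_set_Pi_pmf_bool)
  also have "\<dots> = measure_pmf.expectation (?P A) (\<lambda>f. LINT \<omega>'|M. F (X f) (Y \<omega>'))"
    unfolding M_def
    by (intro Bochner_Integration.integral_cong refl integral_PiM_bool[symmetric] fin determined_by_compose[OF Y])
  also have "\<dots> = (LINT \<omega>|M. (LINT \<omega>'|M. F (X \<omega>) (Y \<omega>')))"
    unfolding M_def by (intro integral_PiM_bool[symmetric] fin determined_by_compose[OF X])
  finally show ?thesis .
qed

lemma integral_PiM_component:
  fixes f :: "bool \<Rightarrow> real"
  assumes "0 \<le> q" "q \<le> 1"
  shows "(LINT \<omega>|PiM UNIV (\<lambda>_. measure_pmf (bernoulli_pmf q)). f (\<omega> i)) = q * f True + (1 - q) * f False"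
proof -
  have "determined_by {i} (\<lambda>\<omega>. f (\<omega> i))" by (simp add: determined_by_def)
  then show ?thesis
    using assms by (subst integral_PiM_bool) (auto simp: Pi_pmf_singleton)
qed

section \<open>Independent subnetworks and the distribution of the resistance\<close>

primrec coins :: "nat \<Rightarrow> arc \<Rightarrow> arc set" where
  "coins 0 e = {}"
| "coins (Suc n) e = insert e (\<Union>c\<in>diamond_arcs e. coins n c)"

lemma coins_subset: "coins n e \<subseteq> descendants e"
proof (induction n arbitrary: e)
  case (Suc n)
  then show ?case unfolding coins.simps by (blast intro: child_descendant descendants_refl)
qed simp

lemma finite_coins: "finite (coins n e)"
proof (induction n arbitrary: e)
  case (Suc n)
  then show ?case by (cases e) simp
qed simp

lemma determined_by_res: "determined_by (coins n e) (\<lambda>\<omega>. res n \<omega> e)"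
proof (induction n arbitrary: e)
  case (Suc n)
  obtain u w where e: "e = (u, w)" by (cases e)
  have "res (Suc n) \<omega> e = res (Suc n) \<omega>' e" if eq: "\<And>i. i \<in> coins (Suc n) e \<Longrightarrow> \<omega> i = \<omega>' i" for \<omega> \<omega>'
  proof -
    have "res n \<omega> c = res n \<omega>' c" if "c \<in> diamond_arcs e" for c
      using that eq by (intro determined_byD[OF Suc]) auto
    moreover have "\<omega> e = \<omega>' e" using eq by simp
    ultimately show ?thesis by (simp add: e)
  qed
  then show ?case unfolding determined_by_def by blast
qed (simp add: determined_by_def)

text \<open>Integrates out one subnetwork by independence. Its law \<open>L\<close> is an
  assumption, to be supplied by the induction hypothesis.\<close>

lemma integral_split_res:
  fixes F :: "real \<Rightarrow> 'b \<Rightarrow> real"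
  defines "M \<equiv> \<lambda>P. PiM UNIV (\<lambda>_. measure_pmf P)"
  assumes L: "\<And>f. (LINT \<omega>|M P. f (res n \<omega> c)) = L f"
    and Y: "determined_by B Y" and B: "finite B" "coins n c \<inter> B = {}"
  shows "(LINT \<omega>|M P. F (res n \<omega> c) (Y \<omega>)) = L (\<lambda>x. LINT \<omega>|M P. F x (Y \<omega>))"
proof -
  have "(LINT \<omega>|M P. F (res n \<omega> c) (Y \<omega>)) =
      (LINT \<omega>|M P. (LINT \<omega>'|M P. F (res n \<omega> c) (Y \<omega>')))"
    unfolding M_def by (rule integral_PiM_disjoint[OF finite_coins B determined_by_res Y])
  also have "\<dots> = L (\<lambda>x. LINT \<omega>|M P. F x (Y \<omega>))"
    by (rule L)
  finally show ?thesis .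
qed

text \<open>The coin of \<open>e\<close> is separated from the coins below it, then the resistances
  of the four potential children are integrated out one after another.\<close>

lemma integral_res:
  assumes q: "0 \<le> q" "q \<le> 1"
  shows "(LINT \<omega>|PiM UNIV (\<lambda>_. measure_pmf (bernoulli_pmf q)). f (res n \<omega> e)) = res_law q n f"
proof (induction n arbitrary: e f)
  case 0
  interpret prob_space "PiM UNIV (\<lambda>_ :: arc. measure_pmf (bernoulli_pmf q))"
    by (intro prob_space_PiM measure_pmf.prob_space_axioms)
  show ?case by (simp add: prob_space)
next
  case (Suc n)
  let ?M = "PiM UNIV (\<lambda>_ :: arc. measure_pmf (bernoulli_pmf q))"
  let ?L = "res_law q n"
  interpret expectation_functional ?L
    by (rule expectation_functional_res_law[OF q])
  obtain u w where e: "e = (u, w)" by (cases e)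
  \<comment> \<open>Index \<open>i\<close> selects the branch, \<open>j\<close> its first or second
    half.\<close>
  define c where "c i j = (if j then (Mid u w i, w) else (u, Mid u w i))" for i j
  have c_child: "c i j \<in> diamond_arcs e" for i j by (cases i; cases j) (simp_all add: c_def e)
  have c_inj: "c i j = c i' j' \<longleftrightarrow> i = i' \<and> j = j'" for i j i' j'
    by (cases j; cases j') (simp_all add: c_def)
  have disj: "coins n (c i j) \<inter> coins n (c i' j') = {}" if "i \<noteq> i' \<or> j \<noteq> j'" for i j i' j'
  proof -
    have "c i j \<noteq> c i' j'" using that by (simp add: c_inj)
    from siblings_disjoint[OF c_child c_child this] show ?thesis
      using coins_subset[of n "c i j"] coins_subset[of n "c i' j'"] by blast
  qed
  note split = integral_split_res[OF Suc]
  define r where "r i j \<omega> = res n \<omega> (c i j)" for i j \<omega>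
  have r: "determined_by (coins n (c i j)) (r i j)" for i j
    unfolding r_def by (rule determined_by_res)
  have four: "(LINT \<omega>|?M. g (r False False \<omega>) (r False True \<omega>) (r True False \<omega>) (r True True \<omega>)) =
      ?L (\<lambda>x. ?L (\<lambda>y. ?L (\<lambda>z. ?L (\<lambda>t. g x y z t))))" for g
  proof -
    have 1: "(LINT \<omega>|?M. g (r False False \<omega>) (r False True \<omega>) (r True False \<omega>) (r True True \<omega>)) =
        ?L (\<lambda>x. LINT \<omega>|?M. g x (r False True \<omega>) (r True False \<omega>) (r True True \<omega>))"
      using split[where c = "c False False" and F = "\<lambda>x (y, z, t). g x y z t",
          OF determined_by_Pair[OF r[of False True] determined_by_Pair[OF r[of True False] r[of True True]]]]
        by (simp add: finite_coins Int_Un_distrib r_def disj)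
    have 2: "(LINT \<omega>|?M. g x (r False True \<omega>) (r True False \<omega>) (r True True \<omega>)) =
        ?L (\<lambda>y. LINT \<omega>|?M. g x y (r True False \<omega>) (r True True \<omega>))" for x
      using split[where c = "c False True" and F = "\<lambda>y (z, t). g x y z t",
          OF determined_by_Pair[OF r[of True False] r[of True True]]]
        by (simp add: finite_coins Int_Un_distrib r_def disj)
    have 3: "(LINT \<omega>|?M. g x y (r True False \<omega>) (r True True \<omega>)) =
        ?L (\<lambda>z. LINT \<omega>|?M. g x y z (r True True \<omega>))" for x y
      using split[where c = "c True False" and F = "\<lambda>z t. g x y z t", OF r[of True True]]
        by (simp add: finite_coins r_def disj)
    have 4: "(LINT \<omega>|?M. g x y z (r True True \<omega>)) = ?L (\<lambda>t. g x y z t)" for x y z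
      unfolding r_def by (rule Suc)
    show ?thesis unfolding 1 2 3 4 ..
  qed
  \<comment> \<open>All four resistances are passed in either case; for a series \<open>z\<close>
    and \<open>t\<close> are ignored, and \<open>const\<close> removes their expectations.\<close>
  define F where "F b = (\<lambda>(x, y, z, t). f (if b then parallel (x + y) (z + t) else x + y))" for b
  let ?Y = "\<lambda>\<omega>. (r False False \<omega>, r False True \<omega>, r True False \<omega>, r True True \<omega>)"
  let ?B = "\<Union>d\<in>diamond_arcs e. coins n d"
  have "(LINT \<omega>|?M. f (res (Suc n) \<omega> e)) = (LINT \<omega>|?M. F (\<omega> e) (?Y \<omega>))"
    by (simp add: e F_def r_def c_def Let_def)
  also have "\<dots> = (LINT \<omega>|?M. (LINT \<omega>'|?M. F (\<omega> e) (?Y \<omega>')))"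
  proof (rule integral_PiM_disjoint[where A = "{e}" and B = ?B])
    have sub: "coins n (c i j) \<subseteq> ?B" for i j using c_child by blast
    show "determined_by ?B ?Y"
      by (rule determined_by_mono[OF determined_by_Pair[OF r determined_by_Pair[OF r determined_by_Pair[OF r r]]]]) (use sub in blast)
    show "finite ?B" by (simp add: e finite_coins)
    show "{e} \<inter> ?B = {}"
      using not_descendant_of_child[of _ e] coins_subset[of n] by blast
  qed (simp_all add: determined_by_def)
  also have "\<dots> = q * (LINT \<omega>'|?M. F True (?Y \<omega>')) + (1 - q) * (LINT \<omega>'|?M. F False (?Y \<omega>'))"
    by (rule integral_PiM_component[OF q])
  also have "\<dots> = res_law q (Suc n) f"
    using four[of "\<lambda>x y z t. f (parallel (x + y) (z + t))"] four[of "\<lambda>x y z t. f (x + y)"]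
    by (simp add: F_def sum_law_def const)
  finally show ?case .
qed

section \<open>The critical parameter\<close>

lemma p_diamond_p_c: "p_diamond p_c = sqrt 5 - 2"
proof -
  \<comment> \<open>The golden ratio equation reduces every power of \<open>p_c\<close> to a linear
    expression; the denominator becomes \<open>p_c\<close> itself.\<close>
  have sq: "p_c\<^sup>2 = 1 - p_c"
    by (simp add: p_c_def power2_eq_square field_simps)
  then have "p_c ^ 4 = (1 - p_c)\<^sup>2"
    by (metis numeral_Bit0 power2_eq_square power_add)
  then have four: "p_c ^ 4 = 2 - 3 * p_c"
    using sq by (simp add: power2_eq_square algebra_simps)
  have "2 * p_c\<^sup>2 - p_c ^ 4 = p_c"
    by (simp add: four sq)
  moreover have "p_c ^ 4 = (2 * p_c - 1) * p_c"
    using sq four by (simp add: power2_eq_square algebra_simps)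
  moreover have "0 < p_c" by (simp add: p_c_def)
  ultimately have "p_diamond p_c = 2 * p_c - 1"
    by (simp add: p_diamond_def)
  then show ?thesis by (simp add: p_c_def field_simps)
qed

theorem proposition4p7:
  shows "\<alpha> p_c \<ge> ln ((14 - 4 * sqrt 5) / 3) \<and> ln ((14 - 4 * sqrt 5) / 3) > 0"
proof
  define q where "q = p_diamond p_c"
  have sqrt5: "2 < sqrt 5" "sqrt 5 < 5 / 2"
    by (rule real_less_rsqrt real_less_lsqrt; simp add: power2_eq_square)+
  then have q: "0 \<le> q" "q \<le> 1 / 2" by (simp_all add: q_def p_diamond_p_c)
  have "(LINT \<omega>|coin_space p_c. R n \<omega>) = res_law q n (\<lambda>x. x)" for n
    unfolding R_eq_res coin_space_def q_def[symmetric] using q by (intro integral_res) auto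
  then have "ln (2 - 4 / 3 * q) \<le> \<alpha> p_c"
    using lim_ln_mean_ge[OF q] by (simp add: \<alpha>_def)
  also have "2 - 4 / 3 * q = (14 - 4 * sqrt 5) / 3"
    by (simp add: q_def p_diamond_p_c field_simps)
  finally show "\<alpha> p_c \<ge> ln ((14 - 4 * sqrt 5) / 3)" .
  show "ln ((14 - 4 * sqrt 5) / 3) > 0"
    using sqrt5 by (intro ln_gt_zero) simp
qed

end
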